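(* Let $X$ be a median algebra, and let $\mathcal H(X)$ denote the family of all halfspaces of $X$. Then: (1) A family $\mathcal F\subset\mathcal H(X)$ of halfspaces is pairwise crossing if and only if it is independent. In particular, $\operatorname{rank}(X)=\operatorname{ind}(\mathcal H(X))$. (2) $\operatorname{rank}(X)=\operatorname{ind}(\mathcal M)$, where $\mathcal M=\mathcal M(X,[0,1])$ is the family of all median-preserving maps $X\to[0,1]$.
   Context: A median algebra is a set $X$ with a ternary operation $m:X^3\to X$ such that $m$ is invariant under permutations of its arguments, $m(a,b,b)=b$, and $m(m(a,x,b),x,c)=m(a,x,m(b,x,c))$ for all $a,b,c,x\in X$. A map $f:X_1\to X_2$ between median algebras is median-preserving if $f(m(x,y,z))=m(f(x),f(y),f(z))$ for all $x,y,z$. The interval $[0,1]\subset\mathbb R$ is a median algebra with $m(a,b,c)$ the middle value of $a,b,c$; $\{0,1\}^n$ carries the coordinatewise median. For $x,y\in X$ put $[x,y]=\{z\in X: m(x,y,z)=z\}$; a subset $C\subseteq X$ is convex if $[x,y]\subseteq C$ for all $x,y\in C$. A halfspace is a nonempty convex subset $H\subset X$ whose complement $H^c=X\setminus H$ is also nonempty and convex. The rank $\operatorname{rank}(X)\in\mathbb N\cup\{\infty\}$ is the supremum of the $n\in\mathbb N$ such that $\{0,1\}^n$ embeds in $X$ as a median subalgebra. Two subsets $A_1,A_2\subseteq X$ are crossing if all four sets $A_1\cap A_2$, $A_1\cap A_2^c$, $A_1^c\cap A_2$, $A_1^c\cap A_2^c$ are nonempty; a family is pairwise crossing if any two distinct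 members are crossing. A family $\mathcal A$ of subsets of $X$ is independent if $\bigcap_{A\in P}A\cap\bigcap_{B\in M}(X\setminus B)\neq\varnothing$ for all finite disjoint subfamilies $P,M\subset\mathcal A$. For a family $\mathcal C$ of subsets of $X$, $\operatorname{ind}(\mathcal C)\in\mathbb N\cup\{\infty\}$ is the supremum of the cardinalities of finite independent subfamilies of $\mathcal C$. A finite sequence $f_1,\dots,f_k$ of real-valued functions on $X$ is independent if there are reals $a<b$ such that $\bigcap_{i\in P}f_i^{-1}(-\infty,a]\cap\bigcap_{j\in M}f_j^{-1}[b,\infty)\neq\varnothing$ for all disjoint $P,M\subset\{1,\dots,k\}$. For a family $\mathcal F$ of real-valued functions on $X$, $\operatorname{ind}(\mathcal F)$ is the supremum of the integers $k$ such that $\mathcal F$ contains an independent sequence of length $k$. *)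

theory Defs
  imports Complex_Main "HOL-Library.FuncSet" "HOL-Library.Extended_Nat"
begin

text \<open>
  The two symmetry laws are adjacent transpositions and hence give invariance under all
  permutations of the arguments.  The carrier is allowed to be empty.
\<close>

locale median_algebra =
  fixes X :: "'a set" and m :: "'a \<Rightarrow> 'a \<Rightarrow> 'a \<Rightarrow> 'a"
  assumes median_closed: "\<lbrakk>a \<in> X; b \<in> X; c \<in> X\<rbrakk> \<Longrightarrow> m a b c \<in> X"
    and median_swap12: "\<lbrakk>a \<in> X; b \<in> X; c \<in> X\<rbrakk> \<Longrightarrow> m a b c = m b a c"
    and median_swap23: "\<lbrakk>a \<in> X; b \<in> X; c \<in> X\<rbrakk> \<Longrightarrow> m a b c = m a c b"
    and median_majority: "\<lbrakk>a \<in> X; b \<in> X\<rbrakk> \<Longrightarrow> m a b b = b"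
    and median_assoc:
      "\<lbrakk>a \<in> X; b \<in> X; c \<in> X; x \<in> X\<rbrakk> \<Longrightarrow> m (m a x b) x c = m a x (m b x c)"

definition median_preserving_on ::
    "'a set \<Rightarrow> ('a \<Rightarrow> 'a \<Rightarrow> 'a \<Rightarrow> 'a) \<Rightarrow> ('b \<Rightarrow> 'b \<Rightarrow> 'b \<Rightarrow> 'b) \<Rightarrow> ('a \<Rightarrow> 'b) \<Rightarrow> bool" where
  "median_preserving_on X m m' f \<longleftrightarrow>
     (\<forall>x\<in>X. \<forall>y\<in>X. \<forall>z\<in>X. f (m x y z) = m' (f x) (f y) (f z))"

definition middle :: "'a::linorder \<Rightarrow> 'a \<Rightarrow> 'a \<Rightarrow> 'a" where
  "middle a b c = max (min a b) (max (min b c) (min a c))"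

lemma middle_eq: "a \<le> b \<Longrightarrow> b \<le> c \<Longrightarrow> middle a b c = b"
  by (simp add: middle_def)

lemma median_algebra_middle:
  assumes "\<And>a b c. \<lbrakk>a \<in> X; b \<in> X; c \<in> X\<rbrakk> \<Longrightarrow> middle a b c \<in> X"
  shows "median_algebra X middle"
proof
  have middle_conv: "middle a x b =
      (if a \<le> x \<and> b \<le> x then max a b else if x \<le> a \<and> x \<le> b then min a b else x)"
    for a b x :: 'a
    by (auto simp: middle_def max_def min_def)
  show "middle (middle a x b) x c = middle a x (middle b x c)" for a b c x :: 'a
    by (auto simp: middle_conv[of _ x] ac_simps le_max_iff_disj min_le_iff_disj)
qed (use assms in \<open>auto simp: middle_def ac_simps\<close>)

lemma median_algebra_unit_interval: "median_algebra {0..1::real} middle"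
  by (rule median_algebra_middle) (auto simp: middle_def max_def min_def)

definition cube :: "nat \<Rightarrow> (nat \<Rightarrow> nat) set" where
  "cube n = {..<n} \<rightarrow>\<^sub>E {0, 1}"

definition cube_median ::
    "nat \<Rightarrow> (nat \<Rightarrow> nat) \<Rightarrow> (nat \<Rightarrow> nat) \<Rightarrow> (nat \<Rightarrow> nat) \<Rightarrow> (nat \<Rightarrow> nat)" where
  "cube_median n x y z = (\<lambda>i\<in>{..<n}. middle (x i) (y i) (z i))"

lemma median_algebra_cube: "median_algebra (cube n) (cube_median n)"
proof -
  interpret two: median_algebra "{0, 1::nat}" middle
    by (rule median_algebra_middle) (auto simp: middle_def)
  have in_two: "x i \<in> {0, 1}" if "x \<in> cube n" "i < n" for x i
    using that unfolding cube_def by blast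
  have eqI: "x = y" if "x \<in> cube n" "y \<in> cube n" "\<And>i. i < n \<Longrightarrow> x i = y i" for x y
    using that unfolding cube_def by (auto intro: PiE_ext)
  have nth: "cube_median n x y z i = middle (x i) (y i) (z i)" if "i < n" for x y z i
    using that by (simp add: cube_median_def)
  have closed: "cube_median n x y z \<in> cube n"
    if "x \<in> cube n" "y \<in> cube n" "z \<in> cube n" for x y z
    unfolding cube_def
  proof (rule PiE_I)
    fix i assume "i \<in> {..<n}"
    then show "cube_median n x y z i \<in> {0, 1}"
      using two.median_closed[OF in_two[OF that(1)] in_two[OF that(2)] in_two[OF that(3)]]
      by (metis lessThan_iff nth)
  qed (simp add: cube_median_def)
  show ?thesis
  proof
    fix a b c x assume *: "a \<in> cube n" "b \<in> cube n" "c \<in> cube n"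
    show "cube_median n a b c \<in> cube n" by (rule closed[OF *])
    show "cube_median n a b c = cube_median n b a c"
      by (rule eqI) (simp_all only: closed * nth two.median_swap12 in_two)
    show "cube_median n a b c = cube_median n a c b"
      by (rule eqI) (simp_all only: closed * nth two.median_swap23[OF in_two in_two in_two, of a _ b _ c])
    assume x: "x \<in> cube n"
    show "cube_median n (cube_median n a x b) x c = cube_median n a x (cube_median n b x c)"
      by (rule eqI) (simp_all only: closed * x nth two.median_assoc in_two)
  next
    fix a b assume *: "a \<in> cube n" "b \<in> cube n"
    show "cube_median n a b b = b"
      by (rule eqI) (simp_all only: closed * nth two.median_majority in_two)
  qed
qed

definition median_rank :: "'a set \<Rightarrow> ('a \<Rightarrow> 'a \<Rightarrow> 'a \<Rightarrow> 'a) \<Rightarrow> enat" where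
  "median_rank X m = Sup {enat n | n.
     \<exists>f. f \<in> cube n \<rightarrow> X \<and> inj_on f (cube n) \<and> median_preserving_on (cube n) (cube_median n) m f}"

definition median_interval :: "'a set \<Rightarrow> ('a \<Rightarrow> 'a \<Rightarrow> 'a \<Rightarrow> 'a) \<Rightarrow> 'a \<Rightarrow> 'a \<Rightarrow> 'a set" where
  "median_interval X m x y = {z \<in> X. m x y z = z}"

definition median_convex :: "'a set \<Rightarrow> ('a \<Rightarrow> 'a \<Rightarrow> 'a \<Rightarrow> 'a) \<Rightarrow> 'a set \<Rightarrow> bool" where
  "median_convex X m C \<longleftrightarrow> C \<subseteq> X \<and> (\<forall>x\<in>C. \<forall>y\<in>C. median_interval X m x y \<subseteq> C)"

definition halfspaces :: "'a set \<Rightarrow> ('a \<Rightarrow> 'a \<Rightarrow> 'a \<Rightarrow> 'a) \<Rightarrow> 'a set set" where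
  "halfspaces X m = {H. H \<subseteq> X \<and> H \<noteq> {} \<and> median_convex X m H \<and>
                        X - H \<noteq> {} \<and> median_convex X m (X - H)}"

definition crossing :: "'a set \<Rightarrow> 'a set \<Rightarrow> 'a set \<Rightarrow> bool" where
  "crossing X A B \<longleftrightarrow> A \<inter> B \<noteq> {} \<and> A \<inter> (X - B) \<noteq> {} \<and>
                      (X - A) \<inter> B \<noteq> {} \<and> (X - A) \<inter> (X - B) \<noteq> {}"

definition pairwise_crossing :: "'a set \<Rightarrow> 'a set set \<Rightarrow> bool" where
  "pairwise_crossing X \<A> \<longleftrightarrow> (\<forall>A\<in>\<A>. \<forall>B\<in>\<A>. A \<noteq> B \<longrightarrow> crossing X A B)"

text \<open>
  The intersection with \<open>X\<close> only matters for \<open>P = M = {}\<close>: the empty intersection of subsets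
  of \<open>X\<close> is \<open>X\<close> itself.  In particular, the empty family is independent iff \<open>X\<close> is nonempty.
\<close>

definition independent_family :: "'a set \<Rightarrow> 'a set set \<Rightarrow> bool" where
  "independent_family X \<A> \<longleftrightarrow>
     (\<forall>P M. finite P \<and> finite M \<and> P \<subseteq> \<A> \<and> M \<subseteq> \<A> \<and> P \<inter> M = {} \<longrightarrow>
        X \<inter> (\<Inter>A\<in>P. A) \<inter> (\<Inter>B\<in>M. X - B) \<noteq> {})"

definition ind_sets :: "'a set \<Rightarrow> 'a set set \<Rightarrow> enat" where
  "ind_sets X \<C> = Sup {enat (card \<A>) | \<A>. \<A> \<subseteq> \<C> \<and> finite \<A> \<and> independent_family X \<A>}"

definition independent_sequence :: "'a set \<Rightarrow> nat \<Rightarrow> (nat \<Rightarrow> 'a \<Rightarrow> real) \<Rightarrow> bool" where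
  "independent_sequence X k f \<longleftrightarrow>
     (\<exists>a b. a < b \<and>
        (\<forall>P M. P \<subseteq> {1..k} \<and> M \<subseteq> {1..k} \<and> P \<inter> M = {} \<longrightarrow>
           X \<inter> (\<Inter>i\<in>P. f i -` {..a}) \<inter> (\<Inter>j\<in>M. f j -` {b..}) \<noteq> {}))"

definition ind_functions :: "'a set \<Rightarrow> ('a \<Rightarrow> real) set \<Rightarrow> enat" where
  "ind_functions X \<F> =
     Sup {enat k | k. \<exists>f. (\<forall>i\<in>{1..k}. f i \<in> \<F>) \<and> independent_sequence X k f}"

definition median_maps_unit_interval ::
    "'a set \<Rightarrow> ('a \<Rightarrow> 'a \<Rightarrow> 'a \<Rightarrow> 'a) \<Rightarrow> ('a \<Rightarrow> real) set" where
  "median_maps_unit_interval X m = {f \<in> X \<rightarrow>\<^sub>E {0..1}. median_preserving_on X m middle f}"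

end

theory Submission
  imports Defs
begin

text \<open>
  Two points of a median algebra are separated by a halfspace: a convex set that contains the one
  and is maximal among those avoiding the other has a convex complement.  Hence an identity between
  medians holds as soon as it holds for the membership in each halfspace, where the median is the
  majority vote.  Pairwise intersecting convex sets have the Helly property, so pairwise crossing
  halfspaces are independent.  A cube in \<open>X\<close> gives independent halfspaces by separating the images
  of \<open>0\<close> and of the unit vectors; conversely, a cube is built from points in the cells of
  independent halfspaces by lattice operations in an interval.  Halfspaces and maps to \<open>[0, 1]\<close>
  correspond through indicator functions and sublevel sets.
\<close>

section \<open>Pointwise forms of independence and of the middle value\<close>

lemma independent_family_iff:
  "independent_family X \<A> \<longleftrightarrow>
    (\<forall>P M. finite P \<and> finite M \<and> P \<subseteq> \<A> \<and> M \<subseteq> \<A> \<and> P \<inter> M = {} \<longrightarrow>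
      (\<exists>x\<in>X. (\<forall>A\<in>P. x \<in> A) \<and> (\<forall>B\<in>M. x \<notin> B)))"
proof -
  have "X \<inter> (\<Inter>A\<in>P. A) \<inter> (\<Inter>B\<in>M. X - B) \<noteq> {} \<longleftrightarrow>
      (\<exists>x\<in>X. (\<forall>A\<in>P. x \<in> A) \<and> (\<forall>B\<in>M. x \<notin> B))" for P M
    unfolding ex_in_conv[symmetric] Int_iff INT_iff Diff_iff by metis
  then show ?thesis
    unfolding independent_family_def by presburger
qed

text \<open>Brings the supremum into the shape used by \<open>median_rank\<close> and
  \<open>ind_functions\<close>, so that equality of ranks reduces to an equivalence for each
  \<open>k\<close>.\<close>

lemma ind_sets_eq:
  "ind_sets X \<C> =
    Sup {enat k | k. \<exists>\<A>\<subseteq>\<C>. finite \<A> \<and> independent_family X \<A> \<and> card \<A> = k}"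
  unfolding ind_sets_def by (rule arg_cong[where f = Sup]) blast

lemma independent_sequence_iff:
  "independent_sequence X k f \<longleftrightarrow>
    (\<exists>a b. a < b \<and> (\<forall>P M. P \<subseteq> {1..k} \<and> M \<subseteq> {1..k} \<and> P \<inter> M = {} \<longrightarrow>
      (\<exists>x\<in>X. (\<forall>i\<in>P. f i x \<le> a) \<and> (\<forall>j\<in>M. b \<le> f j x))))"
proof -
  have "X \<inter> (\<Inter>i\<in>P. f i -` {..a}) \<inter> (\<Inter>j\<in>M. f j -` {b..}) \<noteq> {} \<longleftrightarrow>
      (\<exists>x\<in>X. (\<forall>i\<in>P. f i x \<le> a) \<and> (\<forall>j\<in>M. b \<le> f j x))" for P M a b
    unfolding ex_in_conv[symmetric] Int_iff INT_iff vimage_eq atMost_iff atLeast_iff by metis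
  then show ?thesis
    unfolding independent_sequence_def by presburger
qed

text \<open>Lying below a threshold is decided by majority vote; this makes sublevel sets and their
  complements convex.\<close>

lemma middle_le_iff:
  "middle x y z \<le> a \<longleftrightarrow> x \<le> a \<and> y \<le> a \<or> y \<le> a \<and> z \<le> a \<or> x \<le> a \<and> z \<le> a"
  unfolding middle_def max.bounded_iff min_le_iff_disj by blast

context median_algebra
begin

section \<open>Intervals, rooted orders and gates\<close>

abbreviation interval :: "'a \<Rightarrow> 'a \<Rightarrow> 'a set" where
  "interval \<equiv> median_interval X m"

lemma interval_iff: "z \<in> interval x y \<longleftrightarrow> z \<in> X \<and> m x y z = z"
  by (simp add: median_interval_def)

lemma interval_carrier: "z \<in> interval x y \<Longrightarrow> z \<in> X"
  by (simp add: interval_iff)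

lemma interval_commute: "x \<in> X \<Longrightarrow> y \<in> X \<Longrightarrow> interval x y = interval y x"
  by (auto simp: interval_iff median_swap12)

lemma endpoint_in_interval: "x \<in> X \<Longrightarrow> y \<in> X \<Longrightarrow> y \<in> interval x y"
  by (simp add: interval_iff median_majority)

lemma interval_refl: "x \<in> X \<Longrightarrow> z \<in> interval x x \<Longrightarrow> z = x"
  using median_swap23[of x x z] median_swap12[of x z x] median_majority[of z x]
  by (simp add: interval_iff)

text \<open>For a fixed root \<open>w\<close>, the operation \<open>m w\<close> is a semilattice
  meet; this is its associativity.\<close>

lemma median_assoc_left:
  "\<lbrakk>w \<in> X; x \<in> X; y \<in> X; z \<in> X\<rbrakk> \<Longrightarrow> m w (m w x y) z = m w x (m w y z)"
  using median_assoc[of x y z w] median_swap12[of w x y] median_swap12[of w y z]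
    median_swap12[of w "m x w y" z] median_swap12[of w x "m y w z"]
  by (simp add: median_closed)

lemma median_in_interval:
  assumes "x \<in> X" "y \<in> X" "z \<in> X"
  shows "m x y z \<in> interval x y"
proof -
  have "m x y (m x y z) = m x (m x y y) z"
    using assms by (metis median_assoc_left median_majority median_closed median_swap23)
  then show ?thesis
    using assms by (simp add: interval_iff median_closed median_majority)
qed

lemma median_in_intervals:
  assumes "x \<in> X" "y \<in> X" "z \<in> X"
  shows "m x y z \<in> interval x y" "m x y z \<in> interval x z" "m x y z \<in> interval y z"
proof -
  have "m x y z = m x z y" "m x y z = m y z x"
    using assms median_swap12 median_swap23 by metis+
  then show "m x y z \<in> interval x y" "m x y z \<in> interval x z" "m x y z \<in> interval y z"
    using assms median_in_interval by metis+
qed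

text \<open>With \<open>x \<in> interval w y\<close> read as \<open>x \<le> y\<close> in the order
  rooted at \<open>w\<close>, the first claim is transitivity; the second places the points in the
  sequence \<open>w\<close>, \<open>x\<close>, \<open>y\<close>, \<open>z\<close>.\<close>

lemma interval_trans:
  assumes "w \<in> X" "z \<in> X" "y \<in> interval w z" "x \<in> interval w y"
  shows "x \<in> interval w z" "y \<in> interval x z"
proof -
  have X: "x \<in> X" "y \<in> X" and eq: "m w z y = y" "m w y x = x"
    using assms by (auto simp: interval_iff)
  show "x \<in> interval w z"
    using assms X eq by (metis interval_iff median_assoc_left median_swap23)
  have "m x y z = m (m x y w) y z"
    using assms X eq by (metis median_swap12 median_swap23)
  also have "\<dots> = m x y (m w y z)"
    using assms X by (simp add: median_assoc)
  also have "\<dots> = y"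
    using assms X eq by (metis median_majority median_swap23)
  finally show "y \<in> interval x z"
    using assms X by (metis interval_iff median_swap23)
qed

lemma interval_antisym:
  "\<lbrakk>w \<in> X; x \<in> interval w y; y \<in> interval w x\<rbrakk> \<Longrightarrow> x = y"
  by (metis interval_iff median_swap23)

text \<open>In the order rooted at \<open>w\<close>, \<open>m w x y\<close> is the greatest lower
  bound of \<open>x\<close> and \<open>y\<close>.\<close>

lemma interval_inf:
  assumes "w \<in> X" "x \<in> X" "y \<in> X" "v \<in> interval w x" "v \<in> interval w y"
  shows "v \<in> interval w (m w x y)"
  using assms by (metis interval_iff median_assoc_left)

text \<open>By \<open>interval_inf\<close>, rooted at \<open>a\<close> and at \<open>b\<close>,
  \<open>z\<close> lies between \<open>?u\<close> and each of \<open>a\<close>, \<open>b\<close>.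
  Rooted at \<open>?u\<close>, it then lies below \<open>m ?u a b\<close>, which is
  \<open>?u\<close> itself.\<close>

lemma median_unique:
  assumes "a \<in> X" "b \<in> X" "c \<in> X"
    and "z \<in> interval a b" "z \<in> interval b c" "z \<in> interval a c"
  shows "z = m a b c"
proof -
  let ?u = "m a b c"
  have u: "?u \<in> X" "z \<in> X"
    using assms by (auto simp: interval_iff median_closed)
  have "?u = m b a c"
    using assms median_swap12 by blast
  then have "z \<in> interval a ?u" "z \<in> interval b ?u"
    using assms interval_inf by (metis interval_commute)+
  then have "z \<in> interval ?u (m ?u a b)"
    using assms u by (metis interval_commute interval_inf)
  moreover have "m ?u a b = ?u"
    using assms u median_in_interval[of a b c] unfolding interval_iff
    by (metis median_swap12 median_swap23)
  ultimately show ?thesis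
    using u interval_refl by metis
qed

text \<open>The median \<open>m a b x\<close> is the gate of \<open>x\<close> in
  \<open>interval a b\<close>: every \<open>c\<close> there is reached from \<open>x\<close> through
  it. By \<open>median_unique\<close> it suffices to find a point of \<open>interval x c\<close>
  that lies in all three intervals spanned by \<open>a\<close>, \<open>b\<close>,
  \<open>x\<close>.\<close>

lemma interval_gate:
  assumes "a \<in> X" "b \<in> X" "x \<in> X" "c \<in> interval a b"
  shows "m a b x \<in> interval c x"
proof -
  have c: "c \<in> X" using assms(4) by (rule interval_carrier)
  \<comment> \<open>Two medians approach \<open>x\<close>: \<open>s\<close> lies between
    \<open>x\<close> and both \<open>c\<close> and \<open>a\<close>, and \<open>v\<close>, lying
    between \<open>x\<close> and \<open>s\<close>, inherits this and is also between
    \<open>x\<close> and \<open>b\<close>. Both stay in \<open>interval a b\<close>.\<close>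
  define s v where "s = m x c a" and "v = m x s b"
  have X: "s \<in> X" "v \<in> X"
    using assms(1-3) c by (simp_all add: s_def v_def median_closed)
  have s: "s \<in> interval x c" "s \<in> interval x a" "s \<in> interval c a"
    unfolding s_def using assms(1-3) c by (simp_all add: median_in_intervals)
  have v: "v \<in> interval x s" "v \<in> interval x b" "v \<in> interval s b"
    unfolding v_def using assms(1-3) X by (simp_all add: median_in_intervals)
  have "s \<in> interval a b"
    using interval_trans(1)[OF assms(1,2,4)] s(3) interval_commute[OF assms(1) c] by simp
  then have "v \<in> interval b a"
    using interval_trans(1)[OF assms(2,1), of s v] v(3)
      interval_commute[OF assms(1,2)] interval_commute[OF X(1) assms(2)] by simp
  then have "v \<in> interval a b"
    using interval_commute[OF assms(1,2)] by simp
  moreover have xa: "v \<in> interval x a" and xc: "v \<in> interval x c"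
    using interval_trans(1)[OF assms(3,1) s(2) v(1)] interval_trans(1)[OF assms(3) c s(1) v(1)]
    by blast+
  ultimately have "v = m a b x"
    using median_unique[OF assms(1-3), of v] v(2) interval_commute[OF assms(2,3)]
      interval_commute[OF assms(1,3)] by simp
  then show ?thesis
    using xc interval_commute[OF c assms(3)] by simp
qed

section \<open>Convex sets and separation by halfspaces\<close>

text \<open>Holds because \<open>interval x y\<close> is the image of \<open>X\<close> under
  \<open>m x y\<close>.\<close>

lemma median_convex_iff:
  "median_convex X m C \<longleftrightarrow> C \<subseteq> X \<and> (\<forall>x\<in>C. \<forall>y\<in>C. \<forall>z\<in>X. m x y z \<in> C)"
proof
  assume "median_convex X m C"
  then show "C \<subseteq> X \<and> (\<forall>x\<in>C. \<forall>y\<in>C. \<forall>z\<in>X. m x y z \<in> C)"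
    unfolding median_convex_def using median_in_interval by (meson subset_iff)
next
  assume "C \<subseteq> X \<and> (\<forall>x\<in>C. \<forall>y\<in>C. \<forall>z\<in>X. m x y z \<in> C)"
  then show "median_convex X m C"
    unfolding median_convex_def interval_iff subset_iff by metis
qed

lemma convex_median:
  "\<lbrakk>median_convex X m C; x \<in> C; y \<in> C; z \<in> X\<rbrakk> \<Longrightarrow> m x y z \<in> C"
  unfolding median_convex_iff by blast

text \<open>For nonempty \<open>C\<close> this is the convex hull of \<open>C\<close> and
  \<open>x\<close>. A point \<open>v\<close> between \<open>s \<in> interval c x\<close> and
  \<open>t \<in> interval d x\<close> lies between \<open>x\<close> and \<open>m c d v\<close>,
  which is in \<open>C\<close> by convexity.\<close>

lemma convex_join:
  assumes C: "median_convex X m C" and x: "x \<in> X"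
  shows "median_convex X m (\<Union>c\<in>C. interval c x)"
  unfolding median_convex_def
proof (intro conjI ballI subsetI)
  fix s t v
  assume "s \<in> (\<Union>c\<in>C. interval c x)" "t \<in> (\<Union>c\<in>C. interval c x)" and v: "v \<in> interval s t"
  then obtain c d where cd: "c \<in> C" "d \<in> C" and st: "s \<in> interval c x" "t \<in> interval d x"
    by blast
  have X: "c \<in> X" "d \<in> X" "s \<in> X" "t \<in> X" "v \<in> X"
    using cd st v C median_convex_iff interval_carrier by blast+
  let ?e = "m c d v"
  have e: "?e \<in> C" "?e \<in> X"
    using cd C X convex_median median_closed by auto
  have "m v x c = m c x v" "m v x d = m d x v"
    using X x by (metis median_swap12 median_swap23)+
  then have "m v x c \<in> interval v s" "m v x d \<in> interval v t"
    using interval_gate[OF X(1) x X(5) st(1)] interval_gate[OF X(2) x X(5) st(2)] X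
    by (simp_all add: interval_commute)
  \<comment> \<open>In the order rooted at \<open>v\<close>, this is the meet of \<open>x\<close>,
    \<open>c\<close>, \<open>d\<close>. It is below the gates \<open>m v x c\<close> and
    \<open>m v x d\<close>, hence below \<open>s\<close> and \<open>t\<close>, whose meet is
    \<open>v\<close>; so it equals \<open>v\<close>.\<close>
  let ?k = "m v x (m v c d)"
  have "?k = m v (m v x c) d" "?k = m v (m v x d) c"
    using X x by (metis median_assoc_left median_swap23)+
  then have "?k \<in> interval v (m v x c)" "?k \<in> interval v (m v x d)"
    using X x median_closed median_in_interval by metis+
  then have "?k \<in> interval v s" "?k \<in> interval v t"
    using \<open>m v x c \<in> interval v s\<close> \<open>m v x d \<in> interval v t\<close> interval_trans(1) X by blast+
  then have "?k \<in> interval v (m v s t)"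
    using interval_inf X by blast
  moreover have "m v s t = m s t v" "m s t v = v"
    using v X median_swap12 median_swap23 by (metis, simp add: interval_iff)
  ultimately have "?k = v"
    using interval_refl X by metis
  moreover have "m v c d = ?e" "m ?e x v = m v x ?e"
    using X x e by (metis median_swap12 median_swap23)+
  ultimately have "m ?e x v = v"
    by simp
  then show "v \<in> (\<Union>c\<in>C. interval c x)"
    using e X by (auto simp: interval_iff)
qed (auto simp: interval_iff)

text \<open>In the order rooted at \<open>k\<close>, \<open>q\<close> is below the meet
  \<open>m k x y\<close>. That meet is the gate of \<open>k\<close> in \<open>interval x y\<close>,
  hence below \<open>z\<close>.\<close>

lemma between_common_point:
  assumes "x \<in> X" "y \<in> X" "k \<in> X"
    and "q \<in> interval k x" "q \<in> interval k y" "z \<in> interval x y"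
  shows "q \<in> interval k z"
proof -
  have "q \<in> X" "z \<in> X" using assms by (auto simp: interval_iff)
  moreover have "q \<in> interval k (m k x y)"
    using assms interval_inf by blast
  moreover have "m k x y = m x y k"
    using assms by (metis median_swap12 median_swap23)
  then have "m k x y \<in> interval k z"
    using interval_gate[OF assms(1,2,3,6)] assms(3) \<open>z \<in> X\<close> interval_commute by simp
  ultimately show ?thesis
    using interval_trans(1) assms by blast
qed

lemma maximal_convex_complement:
  assumes C: "median_convex X m C" and q: "q \<in> X" "q \<notin> C" and ne: "C \<noteq> {}"
    and max: "\<And>D. \<lbrakk>median_convex X m D; C \<subseteq> D; q \<notin> D\<rbrakk> \<Longrightarrow> D = C"
  shows "median_convex X m (X - C)"
  unfolding median_convex_def
proof (intro conjI ballI subsetI)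
  have CX: "C \<subseteq> X" using C by (simp add: median_convex_def)
  \<comment> \<open>Otherwise the convex hull of \<open>C\<close> and \<open>x\<close> would be a
    strictly larger convex set avoiding \<open>q\<close>.\<close>
  have join: "\<exists>c\<in>C. q \<in> interval c x" if "x \<in> X - C" for x
  proof (rule ccontr)
    assume none: "\<not> ?thesis"
    let ?D = "\<Union>c\<in>C. interval c x"
    have "c \<in> interval c x \<and> x \<in> interval c x" if "c \<in> C" for c
      using endpoint_in_interval[of x c] endpoint_in_interval[of c x] interval_commute[of c x]
        that CX \<open>x \<in> X - C\<close> by auto
    then have "C \<subseteq> ?D" "x \<in> ?D"
      using ne by blast+
    moreover have "median_convex X m ?D" "q \<notin> ?D" "x \<notin> C"
      using convex_join[OF C, of x] none that by auto
    ultimately show False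
      using max[of ?D] by metis
  qed
  fix x y z
  assume x: "x \<in> X - C" and y: "y \<in> X - C" and z: "z \<in> interval x y"
  obtain c d where c: "c \<in> C" "q \<in> interval c x" and d: "d \<in> C" "q \<in> interval d y"
    using join x y by blast
  have X: "c \<in> X" "d \<in> X" "x \<in> X" "y \<in> X" "z \<in> X"
    using c d x y z CX interval_carrier by blast+
  show "z \<in> X - C"
  proof
    show "z \<notin> C"
    proof
      assume "z \<in> C"
      let ?w = "m q c d"
      have "?w = m c d q"
        using X q by (metis median_swap12 median_swap23)
      then have "?w \<in> C"
        using convex_median[OF C c(1) d(1) q(1)] by simp
      then have w: "?w \<in> C" "?w \<in> X" using CX by auto
      \<comment> \<open>A point of \<open>C\<close> lying below \<open>z\<close>, \<open>c\<close>
        and \<open>d\<close> in the order rooted at \<open>q\<close>. Then \<open>q\<close> is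
        between \<open>?k\<close> and both \<open>x\<close> and \<open>y\<close>, hence between
        \<open>?k\<close> and \<open>z\<close>; as \<open>?k\<close> is between \<open>q\<close> and
        \<open>z\<close>, the two coincide, although \<open>q \<notin> C\<close>.\<close>
      let ?k = "m q z ?w"
      have "?k = m z ?w q"
        using X q w by (metis median_swap12 median_swap23)
      then have "?k \<in> C"
        using convex_median[OF C \<open>z \<in> C\<close> w(1) q(1)] by simp
      then have k: "?k \<in> C" "?k \<in> X" using CX by auto
      have kz: "?k \<in> interval q z" and kw: "?k \<in> interval q ?w"
        using X q w by (simp_all add: median_in_intervals)
      have "?w \<in> interval q c" "?w \<in> interval q d"
        using X q by (simp_all add: median_in_intervals)
      then have kc: "?k \<in> interval q c" and kd: "?k \<in> interval q d"
        using interval_trans(1)[of q c ?w ?k] interval_trans(1)[of q d ?w ?k] kw X q by simp_all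
      have "q \<in> interval ?k x"
        using interval_trans(2)[of c x q ?k] c kc X q interval_commute[of c q] by simp
      moreover have "q \<in> interval ?k y"
        using interval_trans(2)[of d y q ?k] d kd X q interval_commute[of d q] by simp
      ultimately have "q \<in> interval ?k z"
        using between_common_point[of x y ?k q z] X z k by simp
      then have "q = ?k"
        using interval_antisym[of z q ?k] kz X q k interval_commute[of z] by simp
      then show False using k q by simp
    qed
  qed (use X in simp)
qed auto

lemma halfspace_separation:
  assumes p: "p \<in> X" and q: "q \<in> X" and "p \<noteq> q"
  obtains H where "H \<in> halfspaces X m" "p \<in> H" "q \<notin> H"
proof -
  let ?S = "{C. median_convex X m C \<and> p \<in> C \<and> q \<notin> C}"
  have "m p p z = p" if "z \<in> X" for z
    using that p median_majority[of z p] by (metis median_swap12 median_swap23)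
  then have "{p} \<in> ?S"
    using assms by (auto simp: median_convex_iff)
  moreover have "\<Union>\<C> \<in> ?S" if "\<C> \<noteq> {}" "subset.chain ?S \<C>" for \<C>
  proof -
    have "m x y z \<in> \<Union>\<C>" if xy: "x \<in> \<Union>\<C>" "y \<in> \<Union>\<C>" and z: "z \<in> X" for x y z
    proof -
      obtain A B where "A \<in> \<C>" "x \<in> A" "B \<in> \<C>" "y \<in> B" using xy by blast
      moreover from this have "A \<subseteq> B \<or> B \<subseteq> A"
        using \<open>subset.chain ?S \<C>\<close> by (auto simp: subset_chain_def)
      ultimately obtain D where "D \<in> \<C>" "x \<in> D" "y \<in> D" by blast
      moreover from this have "median_convex X m D"
        using \<open>subset.chain ?S \<C>\<close> by (auto simp: subset_chain_def)
      ultimately show ?thesis using z convex_median by blast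
    qed
    moreover have "\<forall>C\<in>\<C>. C \<subseteq> X \<and> p \<in> C \<and> q \<notin> C"
      using \<open>subset.chain ?S \<C>\<close> by (auto simp: subset_chain_def median_convex_def)
    ultimately show ?thesis
      using \<open>\<C> \<noteq> {}\<close> by (auto simp: median_convex_iff)
  qed
  ultimately obtain C where C: "C \<in> ?S" and max: "\<forall>D\<in>?S. C \<subseteq> D \<longrightarrow> D = C"
    using subset_Zorn_nonempty[of ?S] by (metis (no_types, lifting) empty_iff)
  have "median_convex X m (X - C)"
    by (rule maximal_convex_complement[of C q]) (use C max q in auto)
  then have "C \<in> halfspaces X m"
    using C q by (auto simp: halfspaces_def median_convex_def)
  then show ?thesis using that C by blast
qed

section \<open>Majority votes, the Helly property and crossing\<close>

lemma halfspace_complement: "H \<in> halfspaces X m \<Longrightarrow> X - H \<in> halfspaces X m"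
  by (auto simp: halfspaces_def double_diff)

text \<open>Convexity of \<open>H\<close> gives one direction. For the other, if fewer than two of
  the points are in \<open>H\<close>, then at least two are in the complement, which is convex as
  well.\<close>

lemma median_in_halfspace_iff:
  assumes H: "H \<in> halfspaces X m" and X: "x \<in> X" "y \<in> X" "z \<in> X"
  shows "m x y z \<in> H \<longleftrightarrow> x \<in> H \<and> y \<in> H \<or> y \<in> H \<and> z \<in> H \<or> x \<in> H \<and> z \<in> H"
proof -
  have two: "m x y z \<in> K"
    if "K \<in> halfspaces X m" "x \<in> K \<and> y \<in> K \<or> y \<in> K \<and> z \<in> K \<or> x \<in> K \<and> z \<in> K" for K
  proof -
    have "median_convex X m K" using that(1) by (simp add: halfspaces_def)
    moreover have "m x y z = m y z x" "m x y z = m x z y"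
      using X by (metis median_swap12 median_swap23)+
    ultimately show ?thesis
      using convex_median that(2) X by metis
  qed
  show ?thesis
    using two[OF H] two[OF halfspace_complement[OF H]] X by auto
qed

text \<open>For three sets, the median of points chosen in the pairwise intersections is common to
  all; induction extends this to finite families.\<close>

lemma helly:
  assumes "finite \<C>" "\<C> \<noteq> {}" "\<And>C. C \<in> \<C> \<Longrightarrow> median_convex X m C"
    and "\<And>A B. A \<in> \<C> \<Longrightarrow> B \<in> \<C> \<Longrightarrow> A \<inter> B \<noteq> {}"
  shows "\<Inter>\<C> \<noteq> {}"
proof -
  have three: "A \<inter> B \<inter> C \<noteq> {}"
    if conv: "median_convex X m A" "median_convex X m B" "median_convex X m C"
      and ne: "A \<inter> B \<noteq> {}" "B \<inter> C \<noteq> {}" "A \<inter> C \<noteq> {}" for A B C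
  proof -
    obtain a b c where abc: "a \<in> A \<inter> B" "b \<in> B \<inter> C" "c \<in> A \<inter> C"
      using ne by blast
    then have X: "a \<in> X" "b \<in> X" "c \<in> X"
      using conv by (auto simp: median_convex_def)
    have "m a b c = m a c b" "m a b c = m b c a"
      using X by (metis median_swap12 median_swap23)+
    then have "m a b c \<in> A" "m a b c \<in> B" "m a b c \<in> C"
      using convex_median[OF conv(1), of a c b] convex_median[OF conv(2), of a b c]
        convex_median[OF conv(3), of b c a] abc X by auto
    then show ?thesis by blast
  qed
  have inter: "median_convex X m (A \<inter> B)" if "median_convex X m A" "median_convex X m B" for A B
    using that by (auto simp: median_convex_iff)
  \<comment> \<open>The induction carries a convex set \<open>D\<close> meeting every member and
    replaces it by \<open>D \<inter> E\<close>; the case of three sets shows that this still meets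
    the others. In the end \<open>D\<close> is taken from the family.\<close>
  have "median_convex X m D \<Longrightarrow> (\<And>C. C \<in> \<C> \<Longrightarrow> D \<inter> C \<noteq> {}) \<Longrightarrow> D \<inter> \<Inter>\<C> \<noteq> {}"
    if "finite \<C>" "\<C> \<noteq> {}" "\<And>C. C \<in> \<C> \<Longrightarrow> median_convex X m C"
      "\<And>A B. A \<in> \<C> \<Longrightarrow> B \<in> \<C> \<Longrightarrow> A \<inter> B \<noteq> {}" for \<C> D
    using that
  proof (induction \<C> arbitrary: D rule: finite_ne_induct)
    case (singleton C)
    then show ?case by simp
  next
    case (insert E \<C>)
    have "(D \<inter> E) \<inter> \<Inter>\<C> \<noteq> {}"
    proof (rule insert.IH)
      show "median_convex X m (D \<inter> E)" using insert.prems inter by simp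
      show "(D \<inter> E) \<inter> C \<noteq> {}" if "C \<in> \<C>" for C
        using that insert.prems by (intro three) auto
    qed (use insert.prems in auto)
    then show ?case by (simp add: Int_assoc)
  qed
  moreover obtain D where "D \<in> \<C>" using assms by blast
  ultimately show ?thesis using assms by (metis Int_absorb1 Inter_lower inf_bot_right)
qed

text \<open>Crossing makes the chosen halfspaces and complements intersect pairwise, so Helly yields
  a point in their cell. Conversely, the four cells of two halfspaces are instances of
  independence.\<close>

lemma pairwise_crossing_iff_independent:
  assumes "X \<noteq> {}" and \<F>: "\<F> \<subseteq> halfspaces X m"
  shows "pairwise_crossing X \<F> \<longleftrightarrow> independent_family X \<F>"
proof
  assume cross: "pairwise_crossing X \<F>"
  show "independent_family X \<F>"
    unfolding independent_family_iff
  proof (intro allI impI)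
    fix P M
    assume PM: "finite P \<and> finite M \<and> P \<subseteq> \<F> \<and> M \<subseteq> \<F> \<and> P \<inter> M = {}"
    \<comment> \<open>Including \<open>X\<close> keeps the family nonempty when
      \<open>P = M = {}\<close> and places the common point in \<open>X\<close>.\<close>
    let ?\<C> = "insert X (P \<union> (\<lambda>B. X - B) ` M)"
    have mem: "C \<noteq> {} \<and> C \<subseteq> X \<and> median_convex X m C" if "C \<in> ?\<C>" for C
      using that PM \<F> \<open>X \<noteq> {}\<close>
      by (auto simp: halfspaces_def median_convex_iff median_closed subset_iff)
    have "A \<inter> B \<noteq> {}" if A: "A \<in> ?\<C>" and B: "B \<in> ?\<C>" for A B
    proof -
      have side: "\<exists>K. (C = K \<and> K \<in> P) \<or> (C = X - K \<and> K \<in> M)" if "C \<in> ?\<C>" "C \<noteq> X" for C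
        using that by auto
      show ?thesis
      proof (cases "A = X \<or> B = X \<or> A = B")
        case True
        then show ?thesis using mem[OF A] mem[OF B] by auto
      next
        case False
        then obtain K L where K: "A = K \<and> K \<in> P \<or> A = X - K \<and> K \<in> M"
          and L: "B = L \<and> L \<in> P \<or> B = X - L \<and> L \<in> M"
          using side[OF A] side[OF B] by metis
        \<comment> \<open>\<open>K = L\<close> would force \<open>A = B\<close> or a common member
          of \<open>P\<close> and \<open>M\<close>.\<close>
        then have "K \<in> \<F>" "L \<in> \<F>" "K \<noteq> L"
          using PM False by auto
        then have "crossing X K L"
          using cross by (simp add: pairwise_crossing_def)
        then show ?thesis
          using K L by (auto simp: crossing_def)
      qed
    qed
    then have "\<Inter>?\<C> \<noteq> {}"
      using mem PM by (intro helly) auto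
    then obtain x where x: "x \<in> \<Inter>?\<C>" by blast
    then show "\<exists>x\<in>X. (\<forall>A\<in>P. x \<in> A) \<and> (\<forall>B\<in>M. x \<notin> B)"
      by (intro bexI[of _ x]) auto
  qed
next
  assume ind: "independent_family X \<F>"
  have I: "\<exists>x\<in>X. (\<forall>A\<in>P. x \<in> A) \<and> (\<forall>B\<in>M. x \<notin> B)"
    if "finite P" "finite M" "P \<subseteq> \<F>" "M \<subseteq> \<F>" "P \<inter> M = {}" for P M
    using ind that unfolding independent_family_iff by metis
  show "pairwise_crossing X \<F>"
    unfolding pairwise_crossing_def
  proof (intro ballI impI)
    fix A B assume AB: "A \<in> \<F>" "B \<in> \<F>" "A \<noteq> B"
    have "\<exists>x\<in>X. x \<in> A \<and> x \<in> B" using I[of "{A, B}" "{}"] AB by simp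
    moreover have "\<exists>x\<in>X. x \<in> A \<and> x \<notin> B" using I[of "{A}" "{B}"] AB by simp
    moreover have "\<exists>x\<in>X. x \<notin> A \<and> x \<in> B" using I[of "{B}" "{A}"] AB by auto
    moreover have "\<exists>x\<in>X. x \<notin> A \<and> x \<notin> B" using I[of "{}" "{A, B}"] AB by simp
    ultimately show "crossing X A B"
      unfolding crossing_def by blast
  qed
qed

section \<open>Halfspaces and maps to the unit interval\<close>

lemma halfspaces_if_median_preserving:
  assumes f: "median_preserving_on X m middle f"
    and "x \<in> X" "f x \<le> a" "y \<in> X" "\<not> f y \<le> a"
  shows "{x \<in> X. f x \<le> a} \<in> halfspaces X m"
proof -
  have "X - {x \<in> X. f x \<le> a} = {x \<in> X. \<not> f x \<le> a}" by blast
  moreover have "f (m u v w) = middle (f u) (f v) (f w)" if "u \<in> X" "v \<in> X" "w \<in> X" for u v w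
    using f that by (simp add: median_preserving_on_def)
  ultimately show ?thesis
    using assms(2-)
    by (auto simp: halfspaces_def median_convex_iff median_closed middle_le_iff)
qed

lemma median_preserving_indicator:
  assumes H: "H \<in> halfspaces X m"
  shows "(\<lambda>x\<in>X. if x \<in> H then 1 else 0) \<in> median_maps_unit_interval X m"
proof -
  have "(if m x y z \<in> H then 1 else 0) =
      middle (if x \<in> H then 1 else 0) (if y \<in> H then 1 else 0) (if z \<in> H then 1 else (0::real))"
    if "x \<in> X" "y \<in> X" "z \<in> X" for x y z
    using median_in_halfspace_iff[OF H that] by (simp add: middle_def)
  then show ?thesis
    by (auto simp: median_maps_unit_interval_def median_preserving_on_def median_closed)
qed

text \<open>The halfspaces are the sublevel sets at the common threshold \<open>a\<close>; since
  \<open>a < b\<close>, a value at least \<open>b\<close> puts a point in the complement.\<close>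

lemma independent_halfspaces_if_independent_functions:
  assumes f: "\<forall>i\<in>{1..k}. f i \<in> median_maps_unit_interval X m"
    and "independent_sequence X k f"
  shows "\<exists>\<A>\<subseteq>halfspaces X m. finite \<A> \<and> independent_family X \<A> \<and> card \<A> = k"
proof -
  obtain a b where "a < b" and ab: "\<And>P M. \<lbrakk>P \<subseteq> {1..k}; M \<subseteq> {1..k}; P \<inter> M = {}\<rbrakk> \<Longrightarrow>
      \<exists>x\<in>X. (\<forall>i\<in>P. f i x \<le> a) \<and> (\<forall>j\<in>M. b \<le> f j x)"
    using assms(2) unfolding independent_sequence_iff by metis
  have "\<exists>x\<in>X. \<forall>i\<in>{1..k}. f i x \<le> a \<longleftrightarrow> i \<in> S" for S
  proof -
    obtain x where "x \<in> X" "\<forall>i\<in>{1..k} \<inter> S. f i x \<le> a" "\<forall>i\<in>{1..k} - S. b \<le> f i x"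
      using ab[of "{1..k} \<inter> S" "{1..k} - S"] by auto
    then show ?thesis using \<open>a < b\<close> by (intro bexI[of _ x]) force+
  qed
  then obtain x where x: "\<And>S. x S \<in> X" "\<And>S i. i \<in> {1..k} \<Longrightarrow> f i (x S) \<le> a \<longleftrightarrow> i \<in> S"
    by metis
  define H where "H i = {x \<in> X. f i x \<le> a}" for i
  have mem: "x S \<in> H i \<longleftrightarrow> i \<in> S" if "i \<in> {1..k}" for S i
    using x that by (simp add: H_def)
  have "H i \<in> halfspaces X m" if i: "i \<in> {1..k}" for i
    unfolding H_def
  proof (rule halfspaces_if_median_preserving)
    show "median_preserving_on X m middle (f i)"
      using f i by (simp add: median_maps_unit_interval_def)
    show "x {i} \<in> X" "f i (x {i}) \<le> a" "x {} \<in> X" "\<not> f i (x {}) \<le> a"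
      using x i by auto
  qed
  \<comment> \<open>The point \<open>x {i}\<close> lies in \<open>H i\<close> but in no other
    \<open>H j\<close>, so the family really has \<open>k\<close> members.\<close>
  moreover have "inj_on H {1..k}"
    by (rule inj_onI) (metis mem singletonD singletonI)
  moreover have "independent_family X (H ` {1..k})"
    unfolding independent_family_iff
  proof (intro allI impI)
    fix P M
    assume PM: "finite P \<and> finite M \<and> P \<subseteq> H ` {1..k} \<and> M \<subseteq> H ` {1..k} \<and> P \<inter> M = {}"
    have "x {i. H i \<in> P} \<in> A \<longleftrightarrow> A \<in> P" if "A \<in> H ` {1..k}" for A
      using that mem by auto
    then have "\<forall>A\<in>P. x {i. H i \<in> P} \<in> A" "\<forall>B\<in>M. x {i. H i \<in> P} \<notin> B"
      using PM by (meson subset_iff disjoint_iff)+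
    then show "\<exists>x\<in>X. (\<forall>A\<in>P. x \<in> A) \<and> (\<forall>B\<in>M. x \<notin> B)"
      using x(1) by blast
  qed
  ultimately show ?thesis
    by (intro exI[of _ "H ` {1..k}"]) (auto simp: card_image)
qed

text \<open>Because \<open>h\<close> is injective on \<open>I\<close>, each \<open>S\<close> splits
  the finite family into disjoint parts, and \<open>x S\<close> is a point of the resulting
  cell.\<close>

lemma independent_family_points:
  assumes \<A>: "finite \<A>" "independent_family X \<A>" and h: "bij_betw h I \<A>"
  obtains x where "\<And>S. x S \<in> X" "\<And>S i. i \<in> I \<Longrightarrow> x S \<in> h i \<longleftrightarrow> i \<in> S"
proof -
  have "\<exists>x\<in>X. \<forall>i\<in>I. x \<in> h i \<longleftrightarrow> i \<in> S" for S
  proof -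
    let ?P = "h ` (I \<inter> S)" and ?M = "h ` (I - S)"
    have "?P \<subseteq> \<A>" "?M \<subseteq> \<A>" "?P \<inter> ?M = {}"
      using h by (auto simp: bij_betw_def inj_on_def)
    moreover from this have "finite ?P" "finite ?M"
      using \<A>(1) finite_subset by auto
    ultimately obtain x where "x \<in> X" "\<forall>A\<in>?P. x \<in> A" "\<forall>B\<in>?M. x \<notin> B"
      using \<A>(2) unfolding independent_family_iff by metis
    then show ?thesis by blast
  qed
  then show ?thesis using that by metis
qed

lemma independent_functions_if_independent_halfspaces:
  assumes "\<A> \<subseteq> halfspaces X m" "finite \<A>" "independent_family X \<A>"
  shows "\<exists>f. (\<forall>i\<in>{1..card \<A>}. f i \<in> median_maps_unit_interval X m) \<and>
    independent_sequence X (card \<A>) f"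
proof -
  obtain h where h: "bij_betw h {1..card \<A>} \<A>"
    using ex_bij_betw_nat_finite_1[OF assms(2)] by blast
  obtain x where x: "\<And>S. x S \<in> X" "\<And>S i. i \<in> {1..card \<A>} \<Longrightarrow> x S \<in> h i \<longleftrightarrow> i \<in> S"
    using independent_family_points[OF assms(2,3) h] by blast
  define f where "f i = (\<lambda>x\<in>X. if x \<in> h i then 1 else (0::real))" for i
  have "h i \<in> halfspaces X m" if "i \<in> {1..card \<A>}" for i
    using h assms(1) that by (auto simp: bij_betw_def)
  then have "\<forall>i\<in>{1..card \<A>}. f i \<in> median_maps_unit_interval X m"
    unfolding f_def using median_preserving_indicator by blast
  moreover have "independent_sequence X (card \<A>) f"
    unfolding independent_sequence_iff
  \<comment> \<open>Indicator functions have thresholds 0 and 1. The point \<open>x M\<close> lies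
    in exactly those \<open>h i\<close> with \<open>i \<in> M\<close>, so it serves \<open>P\<close>
    and \<open>M\<close> at once.\<close>
  proof (rule exI[of _ 0], rule exI[of _ 1], intro conjI allI impI)
    fix P M assume PM: "P \<subseteq> {1..card \<A>} \<and> M \<subseteq> {1..card \<A>} \<and> P \<inter> M = {}"
    then have "\<forall>i\<in>P. x M \<notin> h i" "\<forall>i\<in>M. x M \<in> h i"
      using x(2) by blast+
    then show "\<exists>x\<in>X. (\<forall>i\<in>P. f i x \<le> 0) \<and> (\<forall>j\<in>M. 1 \<le> f j x)"
      using x(1)[of M] by (intro bexI[of _ "x M"]) (simp_all add: f_def)
  qed simp
  ultimately show ?thesis by blast
qed

section \<open>Halfspaces and cubes\<close>

lemma independent_halfspaces_if_cube_embedding: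
  assumes f: "f \<in> cube n \<rightarrow> X" "inj_on f (cube n)"
    "median_preserving_on (cube n) (cube_median n) m f"
  shows "\<exists>\<A>\<subseteq>halfspaces X m. finite \<A> \<and> independent_family X \<A> \<and> card \<A> = n"
proof -
  \<comment> \<open>The vertex of the cube with support \<open>S \<inter> {..<n}\<close>.\<close>
  define v :: "nat set \<Rightarrow> nat \<Rightarrow> nat" where "v S = (\<lambda>i\<in>{..<n}. if i \<in> S then 1 else 0)" for S
  have v: "v S \<in> cube n" for S
    by (auto simp: v_def cube_def)
  then have fX: "f (v S) \<in> X" for S using f(1) by blast
  have "\<exists>H\<in>halfspaces X m. f (v {i}) \<in> H \<and> f (v {}) \<notin> H" if "i < n" for i
  proof -
    have "v {i} i \<noteq> v {} i" using that by (simp add: v_def)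
    then have "f (v {i}) \<noteq> f (v {})" using f(2) v by (metis inj_on_contraD)
    then show ?thesis using halfspace_separation[OF fX fX] by metis
  qed
  then obtain H where H: "\<And>i. i < n \<Longrightarrow> H i \<in> halfspaces X m"
    "\<And>i. i < n \<Longrightarrow> f (v {i}) \<in> H i" "\<And>i. i < n \<Longrightarrow> f (v {}) \<notin> H i"
    by metis
  have mem: "f (v S) \<in> H i \<longleftrightarrow> i \<in> S" if "i < n" for S i
  proof -
    \<comment> \<open>Under \<open>f\<close>, the vertices \<open>v {}\<close> and
      \<open>v {i}\<close> vote against and for \<open>H i\<close>, so \<open>f (v S)\<close>
      decides the majority. Hence only the \<open>i\<close>th coordinate of a vertex matters for
      \<open>H i\<close>.\<close>
    have "cube_median n (v {}) (v {i}) (v S) = v (S \<inter> {i})"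
      by (auto simp: cube_median_def v_def middle_def fun_eq_iff)
    then have "f (v (S \<inter> {i})) = m (f (v {})) (f (v {i})) (f (v S))"
      using f(3) v unfolding median_preserving_on_def by metis
    then have "f (v (S \<inter> {i})) \<in> H i \<longleftrightarrow> f (v S) \<in> H i"
      using median_in_halfspace_iff[OF H(1)[OF that] fX fX fX] H(2,3)[OF that] by simp
    then show ?thesis
      using H(2,3)[OF that] by (cases "i \<in> S") simp_all
  qed
  have "inj_on H {..<n}"
    by (rule inj_onI) (metis lessThan_iff mem singletonD singletonI)
  moreover have "independent_family X (H ` {..<n})"
    unfolding independent_family_iff
  proof (intro allI impI)
    fix P M
    assume PM: "finite P \<and> finite M \<and> P \<subseteq> H ` {..<n} \<and> M \<subseteq> H ` {..<n} \<and> P \<inter> M = {}"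
    have "f (v {i. H i \<in> P}) \<in> A \<longleftrightarrow> A \<in> P" if "A \<in> H ` {..<n}" for A
      using that mem by auto
    then have "\<forall>A\<in>P. f (v {i. H i \<in> P}) \<in> A" "\<forall>B\<in>M. f (v {i. H i \<in> P}) \<notin> B"
      using PM by (meson subset_iff disjoint_iff)+
    then show "\<exists>x\<in>X. (\<forall>A\<in>P. x \<in> A) \<and> (\<forall>B\<in>M. x \<notin> B)"
      using fX by blast
  qed
  ultimately show ?thesis
    using H(1) by (intro exI[of _ "H ` {..<n}"]) (auto simp: card_image)
qed

lemma foldr_median_closed:
  "\<lbrakk>p \<in> X; q \<in> X; set xs \<subseteq> X\<rbrakk> \<Longrightarrow> foldr (m q) xs p \<in> X"
  by (induction xs) (auto simp: median_closed)

text \<open>With one vote cast by \<open>q \<in> H\<close>, the majority becomes a disjunction: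
  \<open>m q\<close> acts as a join, and \<open>p\<close> is the value of the empty join.\<close>

lemma foldr_median_in_halfspace_iff:
  assumes "H \<in> halfspaces X m" "p \<in> X" "q \<in> X" "set xs \<subseteq> X" "q \<in> H"
  shows "foldr (m q) xs p \<in> H \<longleftrightarrow> p \<in> H \<or> (\<exists>x\<in>set xs. x \<in> H)"
  using assms(4)
proof (induction xs)
  case (Cons x xs)
  then show ?case
    using assms foldr_median_closed[of p q xs]
      median_in_halfspace_iff[of H q x "foldr (m q) xs p"] by auto
qed simp

text \<open>
  Let \<open>p\<close> lie in none of the independent halfspaces, \<open>q\<close> in all of them, and \<open>a i\<close> in the \<open>i\<close>th
  one only.  In the lattice \<open>[p, q]\<close> with join \<open>m q\<close> and meet \<open>m p\<close>, send a vertex \<open>\<epsilon>\<close> to the join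
  of the \<open>a i\<close> with \<open>\<epsilon> i = 1\<close>, together with all meets \<open>m p (a i) (a j)\<close>, \<open>i \<noteq> j\<close>.  Because of
  these meets, a halfspace separating \<open>p\<close> from \<open>q\<close> sees at most one coordinate of \<open>\<epsilon>\<close>.
\<close>

lemma cube_embedding_if_independent_halfspaces:
  assumes \<A>: "\<A> \<subseteq> halfspaces X m" "finite \<A>" "independent_family X \<A>" and n: "card \<A> = n"
  shows "\<exists>f. f \<in> cube n \<rightarrow> X \<and> inj_on f (cube n) \<and>
    median_preserving_on (cube n) (cube_median n) m f"
proof -
  obtain h where h: "bij_betw h {..<n} \<A>"
    using ex_bij_betw_nat_finite[OF \<A>(2)] n by (auto simp: lessThan_atLeast0)
  then have hH: "h i \<in> halfspaces X m" if "i < n" for i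
    using \<A>(1) that by (auto simp: bij_betw_def)
  obtain x where x: "\<And>S. x S \<in> X" and mem: "\<And>S i. i < n \<Longrightarrow> x S \<in> h i \<longleftrightarrow> i \<in> S"
    using independent_family_points[OF \<A>(2,3) h] by (metis lessThan_iff)
  define p q a where "p = x {}" and "q = x {..<n}" and "a i = x {i}" for i
  have X: "p \<in> X" "q \<in> X" "\<And>i. a i \<in> X"
    using x by (auto simp: p_def q_def a_def)
  define E where "E = {m p (a i) (a j) | i j. i < n \<and> j < n \<and> i \<noteq> j}"
  have "finite ((\<lambda>(i, j). m p (a i) (a j)) ` ({..<n} \<times> {..<n}))"
    by simp
  then have "finite E"
    by (rule rev_finite_subset) (auto simp: E_def)
  then obtain es where es: "set es = E"
    using finite_list by blast
  define f where "f \<epsilon> = foldr (m q) (es @ map a (filter (\<lambda>i. \<epsilon> i = 1) [0..<n])) p"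
    for \<epsilon> :: "nat \<Rightarrow> nat"
  have sub: "set (es @ map a (filter (\<lambda>i. \<epsilon> i = 1) [0..<n])) \<subseteq> X" for \<epsilon> :: "nat \<Rightarrow> nat"
    using es X by (auto simp: E_def median_closed)
  have fX: "f \<epsilon> \<in> X" for \<epsilon>
    unfolding f_def by (rule foldr_median_closed[OF X(1,2) sub])
  have inE: "(\<exists>e\<in>E. e \<in> H) \<longleftrightarrow> (\<exists>i<n. \<exists>j<n. i \<noteq> j \<and> a i \<in> H \<and> a j \<in> H)"
    if "H \<in> halfspaces X m" "p \<notin> H" for H
    using median_in_halfspace_iff[OF that(1) X(1) X(3) X(3)] that(2) unfolding E_def by blast
  have f_iff: "f \<epsilon> \<in> H \<longleftrightarrow> p \<in> H \<or> (\<exists>i<n. \<exists>j<n. i \<noteq> j \<and> a i \<in> H \<and> a j \<in> H) \<or>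
      (\<exists>i<n. \<epsilon> i = 1 \<and> a i \<in> H)"
    if H: "H \<in> halfspaces X m" "q \<in> H" for H \<epsilon>
    using foldr_median_in_halfspace_iff[OF H(1) X(1,2) sub H(2), of \<epsilon>] inE[OF H(1)]
    unfolding f_def set_append es by auto
  have pres: "f (cube_median n \<epsilon> \<delta> \<eta>) \<in> H \<longleftrightarrow> m (f \<epsilon>) (f \<delta>) (f \<eta>) \<in> H"
    if c: "\<epsilon> \<in> cube n" "\<delta> \<in> cube n" "\<eta> \<in> cube n" and H: "H \<in> halfspaces X m" "q \<in> H"
    for \<epsilon> \<delta> \<eta> H
  proof -
    \<comment> \<open>If \<open>p\<close> or two distinct \<open>a i\<close>, \<open>a j\<close> are
      in \<open>H\<close>, so is every value of \<open>f\<close>. If \<open>p\<close> and all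
      \<open>a i\<close> are outside, no value is in \<open>H\<close>. Otherwise exactly one
      \<open>a T\<close> is in \<open>H\<close>, and \<open>f\<close> meets \<open>H\<close>
      according to the coordinate \<open>T\<close>.\<close>
    have "\<exists>T. (\<forall>\<epsilon>. f \<epsilon> \<in> H) \<or> (\<forall>\<epsilon>. f \<epsilon> \<notin> H) \<or> (T < n \<and> (\<forall>\<epsilon>. f \<epsilon> \<in> H \<longleftrightarrow> \<epsilon> T = 1))"
      unfolding f_iff[OF H] by metis
    then consider "\<forall>\<epsilon>. f \<epsilon> \<in> H" | "\<forall>\<epsilon>. f \<epsilon> \<notin> H" | i where "i < n" "\<forall>\<epsilon>. f \<epsilon> \<in> H \<longleftrightarrow> \<epsilon> i = 1"
      by blast
    then show ?thesis
    proof cases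
      case 3
      have "\<epsilon> i \<in> {0, 1}" "\<delta> i \<in> {0, 1}" "\<eta> i \<in> {0, 1}"
        using c \<open>i < n\<close> unfolding cube_def by blast+
      then have "middle (\<epsilon> i) (\<delta> i) (\<eta> i) = 1 \<longleftrightarrow>
          \<epsilon> i = 1 \<and> \<delta> i = 1 \<or> \<delta> i = 1 \<and> \<eta> i = 1 \<or> \<epsilon> i = 1 \<and> \<eta> i = 1"
        by (auto simp: middle_def)
      moreover have "cube_median n \<epsilon> \<delta> \<eta> i = middle (\<epsilon> i) (\<delta> i) (\<eta> i)"
        using \<open>i < n\<close> by (simp add: cube_median_def)
      ultimately show ?thesis
        using 3(2) median_in_halfspace_iff[OF H(1) fX fX fX, of \<epsilon> \<delta> \<eta>] by simp
    qed (simp_all add: median_in_halfspace_iff[OF H(1) fX fX fX])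
  qed
  have "f (cube_median n \<epsilon> \<delta> \<eta>) = m (f \<epsilon>) (f \<delta>) (f \<eta>)"
    if c: "\<epsilon> \<in> cube n" "\<delta> \<in> cube n" "\<eta> \<in> cube n" for \<epsilon> \<delta> \<eta>
  proof (rule ccontr)
    have mX: "m (f \<epsilon>) (f \<delta>) (f \<eta>) \<in> X" using fX by (simp add: median_closed)
    assume "\<not> ?thesis"
    then obtain H where H: "H \<in> halfspaces X m" "f (cube_median n \<epsilon> \<delta> \<eta>) \<in> H"
      "m (f \<epsilon>) (f \<delta>) (f \<eta>) \<notin> H"
      using halfspace_separation[OF fX mX] by metis
    \<comment> \<open>Passing to the complement of \<open>H\<close> if necessary, the separating
      halfspace contains \<open>q\<close>, as \<open>pres\<close> requires.\<close>
    show False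
    proof (cases "q \<in> H")
      case True
      then show ?thesis using pres[OF c H(1)] H by simp
    next
      case False
      then show ?thesis using pres[OF c halfspace_complement[OF H(1)]] H X(2) mX by simp
    qed
  qed
  \<comment> \<open>Among \<open>p\<close> and the \<open>a j\<close>, only \<open>a i\<close> is in
    \<open>h i\<close>, so \<open>h i\<close> reads off the \<open>i\<close>th coordinate; this
    gives injectivity.\<close>
  moreover have "f \<epsilon> \<in> h i \<longleftrightarrow> \<epsilon> i = 1" if "i < n" for i \<epsilon>
  proof -
    have "q \<in> h i" "p \<notin> h i" "\<And>j. a j \<in> h i \<longleftrightarrow> j = i"
      using mem[OF that] that by (auto simp: p_def q_def a_def)
    then show ?thesis using f_iff[OF hH[OF that]] that by auto
  qed
  then have "inj_on f (cube n)"
  proof (intro inj_onI)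
    fix \<epsilon> \<delta> assume f: "\<And>i \<epsilon>. i < n \<Longrightarrow> f \<epsilon> \<in> h i \<longleftrightarrow> \<epsilon> i = 1"
      and c: "\<epsilon> \<in> cube n" "\<delta> \<in> cube n" and eq: "f \<epsilon> = f \<delta>"
    have "\<epsilon> i = \<delta> i" if "i \<in> {..<n}" for i
    proof -
      have "\<epsilon> i \<in> {0, 1}" "\<delta> i \<in> {0, 1}"
        using c that unfolding cube_def by blast+
      then show ?thesis using f[of i \<epsilon>] f[of i \<delta>] eq that by auto
    qed
    then show "\<epsilon> = \<delta>"
      using c unfolding cube_def by (intro PiE_ext) auto
  qed
  ultimately show ?thesis
    using fX by (intro exI[of _ f]) (auto simp: median_preserving_on_def)
qed

section \<open>Equality of the ranks\<close>

lemma median_rank_eq_ind_halfspaces: "median_rank X m = ind_sets X (halfspaces X m)"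
proof -
  have "(\<exists>f. f \<in> cube n \<rightarrow> X \<and> inj_on f (cube n) \<and> median_preserving_on (cube n) (cube_median n) m f)
      \<longleftrightarrow> (\<exists>\<A>\<subseteq>halfspaces X m. finite \<A> \<and> independent_family X \<A> \<and> card \<A> = n)" for n
    using independent_halfspaces_if_cube_embedding cube_embedding_if_independent_halfspaces by metis
  then show ?thesis
    unfolding median_rank_def ind_sets_eq by simp
qed

lemma ind_halfspaces_eq_ind_functions:
  "ind_sets X (halfspaces X m) = ind_functions X (median_maps_unit_interval X m)"
proof -
  have "(\<exists>\<A>\<subseteq>halfspaces X m. finite \<A> \<and> independent_family X \<A> \<and> card \<A> = k) \<longleftrightarrow>
      (\<exists>f. (\<forall>i\<in>{1..k}. f i \<in> median_maps_unit_interval X m) \<and> independent_sequence X k f)" for k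
    using independent_functions_if_independent_halfspaces
      independent_halfspaces_if_independent_functions by metis
  then show ?thesis
    unfolding ind_sets_eq ind_functions_def by simp
qed

end

theorem theorem3p2:
  fixes X :: "'a set" and m :: "'a \<Rightarrow> 'a \<Rightarrow> 'a \<Rightarrow> 'a"
  assumes "median_algebra X m"
  shows "(X \<noteq> {} \<longrightarrow>
            (\<forall>\<F> \<subseteq> halfspaces X m. pairwise_crossing X \<F> \<longleftrightarrow> independent_family X \<F>)) \<and>
         median_rank X m = ind_sets X (halfspaces X m) \<and>
         median_rank X m = ind_functions X (median_maps_unit_interval X m)"
proof -
  interpret median_algebra X m by (rule assms)
  show ?thesis
    using pairwise_crossing_iff_independent median_rank_eq_ind_halfspaces
      ind_halfspaces_eq_ind_functions by auto
qed

end
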